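(* Let $T$ be a star on $n$ vertices (one center vertex adjacent to all other $n-1$ vertices, which are pendant). Suppose $A\in M_n(\mathbb{R})$ is T-TP and that, for every pendant vertex $p$ of $T$, the submatrix $A[\{1,\dots,n\}\setminus\{p\}]$ is a $P$-matrix. Then the smallest eigenvalue of $A$ (the eigenvalue of minimum modulus) is real, has multiplicity one, and has an eigenvector $v$ signed according to $T$, i.e. $v_iv_j<0$ for every edge $\{i,j\}$ of $T$ (in particular $v$ is totally nonzero).
   Context: A real matrix is totally positive (TP) if every minor of it is positive; it is a $P$-matrix if all its principal minors are positive. For $A\in M_n(\mathbb{R})$ and an ordered list $\alpha$ of distinct indices, $A[\alpha]$ denotes the principal submatrix with rows and columns indexed by $\alpha$, taken in the order of $\alpha$. For a labelled tree $T$ on vertices $1,\dots,n$ and a path $P$ in $T$, $A[P]$ denotes $A[\alpha]$ where $\alpha$ lists the vertices of $P$ in the order in which they occur along $P$ (the direction is immaterial). $A$ is called T-TP if $A[P]$ is TP for every path $P$ of $T$. A vector $v\in\mathbb{R}^n$ is signed according to $T$ if $v_iv_j<0$ whenever $\{i,j\}$ is an edge of $T$. The "smallest eigenvalue" refers to the eigenvalue of $A$ of smallest absolute value. *)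

theory Defs
  imports
    Complex_Main
    "Jordan_Normal_Form.Char_Poly"
    "Jordan_Normal_Form.DL_Submatrix"
begin

text \<open>
  Row and column indices of matrices start at 0, so a graph on \<open>n\<close> labelled vertices has vertex set
  \<open>{..<n}\<close>. It is given by \<open>n\<close> and its set \<open>E\<close> of edges, each edge being a two-element vertex set.
\<close>

definition is_star :: "nat \<Rightarrow> nat \<Rightarrow> nat set set \<Rightarrow> bool" where
  "is_star n c E \<longleftrightarrow> c < n \<and> E = {{c, p} | p. p < n \<and> p \<noteq> c}"

definition pendant :: "nat \<Rightarrow> nat set set \<Rightarrow> nat \<Rightarrow> bool" where
  "pendant n E p \<longleftrightarrow> p < n \<and> card {e \<in> E. p \<in> e} = 1"

definition is_path :: "nat \<Rightarrow> nat set set \<Rightarrow> nat list \<Rightarrow> bool" where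
  "is_path n E xs \<longleftrightarrow>
     xs \<noteq> [] \<and> set xs \<subseteq> {..<n} \<and> distinct xs \<and> successively (\<lambda>u v. {u, v} \<in> E) xs"

text \<open>
  The principal submatrix \<open>A[\<alpha>]\<close> with rows and columns in the order of the list \<open>\<alpha>\<close>; the library's
  \<^const>\<open>submatrix\<close> always keeps the indices in increasing order.
\<close>

definition ordered_submatrix :: "'a mat \<Rightarrow> nat list \<Rightarrow> 'a mat" where
  "ordered_submatrix A \<alpha> = mat (length \<alpha>) (length \<alpha>) (\<lambda>(i, j). A $$ (\<alpha> ! i, \<alpha> ! j))"

text \<open>
  In the next two definitions the empty index set is harmless: the determinant of the
  \<open>0 \<times> 0\<close> matrix is 1.
\<close>

definition totally_positive :: "real mat \<Rightarrow> bool" where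
  "totally_positive M \<longleftrightarrow>
     (\<forall>I J. I \<subseteq> {..<dim_row M} \<longrightarrow> J \<subseteq> {..<dim_col M} \<longrightarrow> card I = card J \<longrightarrow>
        0 < det (submatrix M I J))"

definition P_matrix :: "real mat \<Rightarrow> bool" where
  "P_matrix M \<longleftrightarrow> square_mat M \<and> (\<forall>I \<subseteq> {..<dim_row M}. 0 < det (submatrix M I I))"

definition T_TP :: "nat \<Rightarrow> nat set set \<Rightarrow> real mat \<Rightarrow> bool" where
  "T_TP n E A \<longleftrightarrow> (\<forall>xs. is_path n E xs \<longrightarrow> totally_positive (ordered_submatrix A xs))"

definition signed_according_to :: "nat set set \<Rightarrow> real vec \<Rightarrow> bool" where
  "signed_according_to E v \<longleftrightarrow> (\<forall>i j. {i, j} \<in> E \<longrightarrow> v $ i * v $ j < 0)"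

definition min_modulus_eigenvalue :: "complex mat \<Rightarrow> complex \<Rightarrow> bool" where
  "min_modulus_eigenvalue M z \<longleftrightarrow>
     eigenvalue M z \<and> (\<forall>w. eigenvalue M w \<longrightarrow> cmod z \<le> cmod w)"

end

theory Submission
  imports Defs "Jordan_Normal_Form.Spectral_Radius"
begin

text \<open>
  Let \<open>S\<close> be the diagonal matrix with entry \<open>1\<close> at the centre and \<open>-1\<close> elsewhere, and \<open>K\<close> the
  adjugate of \<open>A\<close>. Total positivity along the paths makes the off-diagonal entries of the Schur
  complement of the centre negative; together with the \<open>P\<close>-matrix condition, in the form that no
  nonzero vector has its sign reversed, this forces \<open>S K S\<close> to be entrywise positive. Perron's theorem
  gives it a dominant eigenvalue \<open>r > 0\<close> with positive left and right eigenvectors, and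
  \<open>\<mu> = det A / r\<close> is the required eigenvalue of \<open>A\<close>. Using the adjugate instead of the inverse
  leaves the sign of \<open>det A\<close> unrestricted; for \<open>det A = 0\<close> only the one-dimensionality of the kernel
  needs a separate argument. Algebraic simplicity holds because the derivative of the
  characteristic polynomial at \<open>\<mu>\<close> is the trace of the adjugate of \<open>\<mu> - A\<close>.
\<close>

section \<open>Sign reversal and principal minors\<close>

lemma pick_strict_mono_image:
  assumes "strict_mono_on {..<k} g" and "i < k"
  shows "pick (g ` {..<k}) i = g i"
proof -
  have "{a \<in> g ` {..<k}. a < g i} = g ` {..<i}"
    using assms by (auto simp: strict_mono_on_less)
  moreover have "inj_on g {..<i}"
    using assms strict_mono_on_imp_inj_on inj_on_subset
    by (metis lessThan_subset_iff less_imp_le)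
  ultimately have "card {a \<in> g ` {..<k}. a < g i} = i"
    by (simp add: card_image)
  with pick_card_in_set[of "g i" "g ` {..<k}"] assms(2) show ?thesis by auto
qed

text \<open>\<open>submatrix\<close> addresses its entries through \<open>pick\<close>. Enumerating
  both index sets increasingly turns a minor into the determinant of an explicit matrix, the form in
  which minors are handled below.\<close>

lemma submatrix_strict_mono_image:
  assumes f: "strict_mono_on {..<k} f" "f ` {..<k} \<subseteq> {..<dim_row A}"
    and g: "strict_mono_on {..<l} g" "g ` {..<l} \<subseteq> {..<dim_col A}"
  shows "submatrix A (f ` {..<k}) (g ` {..<l}) = mat k l (\<lambda>(i, j). A $$ (f i, g j))"
proof -
  have "{i. i < dim_row A \<and> i \<in> f ` {..<k}} = f ` {..<k}"
    and "{j. j < dim_col A \<and> j \<in> g ` {..<l}} = g ` {..<l}"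
    using f(2) g(2) by auto
  moreover have "card (f ` {..<k}) = k" "card (g ` {..<l}) = l"
    using strict_mono_on_imp_inj_on[OF f(1)] strict_mono_on_imp_inj_on[OF g(1)]
    by (simp_all add: card_image)
  ultimately show ?thesis
    unfolding submatrix_def
    by (intro eq_matI) (auto simp: pick_strict_mono_image[OF f(1)] pick_strict_mono_image[OF g(1)])
qed

lemma strict_mono_on_insert_index: "strict_mono_on S (insert_index p)"
  by (auto simp: strict_mono_on_def insert_index_def)

text \<open>A principal minor of a principal submatrix is a principal minor of \<open>A\<close>:
  \<open>f i\<close> sits in the submatrix at position \<open>g i\<close>, the number of elements of
  \<open>R\<close> below \<open>f i\<close>.\<close>

lemma P_matrix_submatrixD:
  assumes P: "P_matrix (submatrix A R R)" and A: "A \<in> carrier_mat n n" and R: "R \<subseteq> {..<n}"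
    and f: "strict_mono_on {..<k} f" "f ` {..<k} \<subseteq> R"
  shows "0 < det (mat k k (\<lambda>(i, j). A $$ (f i, f j)))"
proof -
  define g where "g i = card {a \<in> R. a < f i}" for i
  have fin: "finite R" using R finite_subset by blast
  have R_eq: "{i. i < n \<and> i \<in> R} = R" using R by auto
  have pick_g: "pick R (g i) = f i" if "i < k" for i
    unfolding g_def using that f(2) by (intro pick_card_in_set) auto
  have g_less: "g i < card R" if "i < k" for i
    unfolding g_def using that f(2) fin by (intro psubset_card_mono) auto
  have mono: "strict_mono_on {..<k} g"
    unfolding g_def
  proof (rule strict_mono_onI, rule psubset_card_mono)
    fix r s assume rs: "r \<in> {..<k}" "s \<in> {..<k}" "r < s"
    then have "f r < f s" "f r \<in> R" using f by (auto simp: strict_mono_on_def)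
    then show "{a \<in> R. a < f r} \<subset> {a \<in> R. a < f s}" by auto
  qed (use fin in auto)
  let ?M = "submatrix A R R"
  have dims: "dim_row ?M = card R" "dim_col ?M = card R"
    using A by (simp_all add: dim_submatrix R_eq)
  have sub: "g ` {..<k} \<subseteq> {..<card R}" using g_less by auto
  have "submatrix ?M (g ` {..<k}) (g ` {..<k}) = mat k k (\<lambda>(i, j). ?M $$ (g i, g j))"
    using mono sub dims by (intro submatrix_strict_mono_image) auto
  also have "\<dots> = mat k k (\<lambda>(i, j). A $$ (f i, f j))"
    using A g_less by (intro eq_matI) (auto simp: submatrix_index R_eq pick_g)
  finally show ?thesis using P sub dims unfolding P_matrix_def by metis
qed

lemma mat_delete_eq_insert_index:
  "mat_delete A p q = mat (dim_row A - 1) (dim_col A - 1) (\<lambda>(i, j). A $$ (insert_index p i, insert_index q j))"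
  by (auto simp: mat_delete_def insert_index_def intro!: eq_matI)

text \<open>In the Laplace expansion along row \<open>k\<close> only the coefficient of one cofactor
  changes, because deleting row \<open>k\<close> removes the altered entry.\<close>

lemma det_update_diagonal:
  fixes A :: "'a :: comm_ring_1 mat"
  assumes "A \<in> carrier_mat n n" and "k < n"
  shows "det (mat n n (\<lambda>(i, j). if i = k \<and> j = k then A $$ (k, k) + t else A $$ (i, j)))
    = det A + t * det (mat_delete A k k)" (is "det ?B = _")
proof -
  have B: "?B \<in> carrier_mat n n" by simp
  have cof: "cofactor ?B k j = cofactor A k j" if "j < n" for j
  proof -
    have "mat_delete ?B k j = mat_delete A k j"
      using assms that by (intro eq_matI) (auto simp: mat_delete_def)
    then show ?thesis by (simp add: cofactor_def)
  qed
  have "det ?B = (\<Sum>j<n. (A $$ (k, j) + (if j = k then t else 0)) * cofactor A k j)"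
    unfolding laplace_expansion_row[OF B assms(2)]
    using assms by (intro sum.cong) (auto simp: cof)
  also have "\<dots> = (\<Sum>j<n. A $$ (k, j) * cofactor A k j) + (\<Sum>j<n. if j = k then t * cofactor A k j else 0)"
    unfolding sum.distrib[symmetric] by (intro sum.cong) (auto simp: algebra_simps)
  also have "\<dots> = det A + t * cofactor A k k"
    using assms by (simp add: laplace_expansion_row[OF assms])
  finally show ?thesis by (simp add: cofactor_def)
qed

text \<open>The determinant is affine in each diagonal entry, with a smaller principal minor as slope.\<close>

lemma det_add_nonneg_diagonal_pos:
  fixes a :: "nat \<Rightarrow> nat \<Rightarrow> real"
  assumes "\<And>k f. strict_mono_on {..<k} f \<Longrightarrow> f ` {..<k} \<subseteq> {..<m} \<Longrightarrow>
      0 < det (mat k k (\<lambda>(i, j). a (f i) (f j)))"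
    and "\<And>i. i < m \<Longrightarrow> 0 \<le> d i"
  shows "0 < det (mat m m (\<lambda>(i, j). a i j + (if i = j then d i else 0)))"
  using assms
proof (induction m arbitrary: a d)
  case 0
  then show ?case by (simp add: det_def)
next
  case (Suc m)
  note outer_IH = Suc.IH and minors_pos = Suc.prems(1) and d_nonneg = Suc.prems(2)
  \<comment> \<open>In \<open>?B t\<close> only the first \<open>t\<close> diagonal increments are
    switched on. Each further one adds \<open>d t\<close> times a principal minor of size
    \<open>m\<close>, which is positive by the outer induction.\<close>
  let ?B = "\<lambda>t. mat (Suc m) (Suc m) (\<lambda>(i, j). a i j + (if i = j \<and> i < t then d i else 0))"
  have "0 < det (?B t)" if "t \<le> Suc m" for t
    using that
  proof (induction t)
    case 0
    then show ?case using minors_pos[of "Suc m" id]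
      by (simp add: strict_mono_on_def cong: if_cong)
  next
    case (Suc t)
    then have t: "t < Suc m" and IH: "0 < det (?B t)" by auto
    have B: "?B t \<in> carrier_mat (Suc m) (Suc m)" by simp
    have "?B (Suc t) = mat (Suc m) (Suc m)
        (\<lambda>(i, j). if i = t \<and> j = t then ?B t $$ (t, t) + d t else ?B t $$ (i, j))"
      using t by (intro eq_matI) auto
    then have eq: "det (?B (Suc t)) = det (?B t) + d t * det (mat_delete (?B t) t t)"
      using det_update_diagonal[OF B t] by simp
    let ?f = "insert_index t"
    have less: "?f i < Suc m" if "i < m" for i using that by (simp add: insert_index_def)
    have del: "mat_delete (?B t) t t = mat m m (\<lambda>(i, j). a (?f i) (?f j) +
        (if i = j then (if ?f i < t then d (?f i) else 0) else 0))"
      using less by (intro eq_matI)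
        (auto simp: mat_delete_eq_insert_index dest: inj_onD[OF insert_index_inj_on[of t UNIV]])
    have "0 < det (mat_delete (?B t) t t)"
      unfolding del
    proof (rule outer_IH)
      fix k and f :: "nat \<Rightarrow> nat"
      assume f: "strict_mono_on {..<k} f" "f ` {..<k} \<subseteq> {..<m}"
      have "strict_mono_on {..<k} (\<lambda>i. ?f (f i))"
        using f(1) strict_mono_on_insert_index[of UNIV t]
        by (auto simp: strict_mono_on_def)
      moreover have "(\<lambda>i. ?f (f i)) ` {..<k} \<subseteq> {..<Suc m}" using f(2) less by auto
      ultimately show "0 < det (mat k k (\<lambda>(i, j). a (?f (f i)) (?f (f j))))"
        using minors_pos[of k "\<lambda>i. ?f (f i)"] by simp
    qed (use d_nonneg less in auto)
    moreover have "0 \<le> d t" using d_nonneg t by simp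
    ultimately show ?case unfolding eq using IH by (simp add: add_pos_nonneg)
  qed
  from this[of "Suc m"] have "0 < det (?B (Suc m))" by simp
  moreover have "?B (Suc m) = mat (Suc m) (Suc m) (\<lambda>(i, j). a i j + (if i = j then d i else 0))"
    by (intro eq_matI) auto
  ultimately show ?case by simp
qed

text \<open>A \<open>P\<close>-matrix reverses the sign of no nonzero vector: if it did, adding a suitable
  nonnegative diagonal on the support of the vector would make the matrix singular.\<close>

lemma no_sign_reversal:
  fixes a :: "nat \<Rightarrow> nat \<Rightarrow> real"
  assumes pos: "\<And>k f. strict_mono_on {..<k} f \<Longrightarrow> f ` {..<k} \<subseteq> R \<Longrightarrow>
      0 < det (mat k k (\<lambda>(i, j). a (f i) (f j)))"
    and R: "R \<subseteq> {..<n}"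
    and supp: "\<And>i. i < n \<Longrightarrow> i \<notin> R \<Longrightarrow> x i = 0"
    and rev: "\<And>i. i \<in> R \<Longrightarrow> x i * (\<Sum>j<n. a i j * x j) \<le> 0"
    and "i < n"
  shows "x i = 0"
proof (rule ccontr)
  assume "x i \<noteq> 0"
  define I where "I = {i \<in> R. x i \<noteq> 0}"
  have fin: "finite I" using R finite_subset unfolding I_def by fastforce
  have iI: "i \<in> I" using \<open>x i \<noteq> 0\<close> supp \<open>i < n\<close> unfolding I_def by blast
  define k where "k = card I"
  define f where "f = pick I"
  have mono: "strict_mono_on {..<k} f"
    unfolding f_def k_def by (auto simp: strict_mono_on_def intro: pick_mono)
  have "f ` {..<k} \<subseteq> I" unfolding f_def k_def by (auto intro: pick_in_set)
  moreover have "card (f ` {..<k}) = k"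
    using strict_mono_on_imp_inj_on[OF mono] by (simp add: card_image)
  ultimately have img: "f ` {..<k} = I" using fin k_def by (metis card_subset_eq)
  have bij: "bij_betw f {..<k} I"
    using img strict_mono_on_imp_inj_on[OF mono] by (simp add: bij_betw_def)
  \<comment> \<open>Chosen so that the perturbed principal submatrix on the support of
    \<open>x\<close> annihilates the restriction of \<open>x\<close>; the sign reversal makes it
    nonnegative.\<close>
  define d where "d i = - (\<Sum>j<n. a (f i) j * x j) / x (f i)" for i
  let ?B = "mat k k (\<lambda>(i, j). a (f i) (f j) + (if i = j then d i else 0))"
  have fI: "f r \<in> R" "x (f r) \<noteq> 0" if "r < k" for r using img that unfolding I_def by auto
  have "0 < det ?B"
  proof (rule det_add_nonneg_diagonal_pos)
    fix l and h :: "nat \<Rightarrow> nat"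
    assume h: "strict_mono_on {..<l} h" "h ` {..<l} \<subseteq> {..<k}"
    have "strict_mono_on {..<l} (\<lambda>i. f (h i))"
      using h mono by (auto simp: strict_mono_on_def subset_iff)
    moreover have "(\<lambda>i. f (h i)) ` {..<l} \<subseteq> R" using h fI by auto
    ultimately show "0 < det (mat l l (\<lambda>(i, j). a (f (h i)) (f (h j))))"
      using pos[of l "\<lambda>i. f (h i)"] by simp
  next
    fix r assume "r < k"
    then have "x (f r) * (\<Sum>j<n. a (f r) j * x j) \<le> 0" "x (f r) \<noteq> 0" using rev fI by auto
    then show "0 \<le> d r" unfolding d_def
      by (auto simp: mult_le_0_iff divide_le_0_iff)
  qed
  moreover have "det ?B = 0"
  proof -
    have B: "?B \<in> carrier_mat k k" by simp
    define y where "y = vec k (\<lambda>r. x (f r))"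
    obtain r where r: "r < k" "f r = i" using img iI by auto
    then have "y $ r \<noteq> 0" unfolding y_def using \<open>x i \<noteq> 0\<close> by simp
    then have "y \<noteq> 0\<^sub>v k" using r by auto
    moreover have "?B *\<^sub>v y = 0\<^sub>v k"
    proof (rule eq_vecI)
      fix r assume "r < dim_vec (0\<^sub>v k)"
      then have r: "r < k" by simp
      have "(?B *\<^sub>v y) $ r = (\<Sum>j<k. (a (f r) (f j) + (if r = j then d r else 0)) * x (f j))"
        using r by (auto simp: scalar_prod_def y_def lessThan_atLeast0 intro!: sum.cong)
      also have "\<dots> = (\<Sum>j<k. a (f r) (f j) * x (f j)) + (\<Sum>j<k. if r = j then d r * x (f j) else 0)"
        unfolding sum.distrib[symmetric] by (intro sum.cong) (auto simp: algebra_simps)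
      also have "(\<Sum>j<k. if r = j then d r * x (f j) else 0) = d r * x (f r)"
        using r by (simp)
      also have "(\<Sum>j<k. a (f r) (f j) * x (f j)) = (\<Sum>j\<in>I. a (f r) j * x j)"
        using sum.reindex_bij_betw[OF bij, of "\<lambda>j. a (f r) j * x j"] by simp
      also have "\<dots> = (\<Sum>j<n. a (f r) j * x j)"
        using R supp unfolding I_def by (intro sum.mono_neutral_left) auto
      also have "\<dots> + d r * x (f r) = 0" unfolding d_def using fI(2)[OF r] by simp
      finally show "(?B *\<^sub>v y) $ r = 0\<^sub>v k $ r" using r by simp
    qed simp
    ultimately show ?thesis
      unfolding det_0_iff_vec_prod_zero[OF B] by (intro exI[of _ y]) (auto simp: y_def)
  qed
  ultimately show False by simp
qed

section \<open>Perron eigenvectors of positive matrices\<close>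

lemma mult_mat_vec_index_sum:
  assumes "A \<in> carrier_mat m n" "x \<in> carrier_vec n" "i < m"
  shows "(A *\<^sub>v x) $ i = (\<Sum>j<n. A $$ (i, j) * x $ j)"
  using assms by (auto simp: scalar_prod_def lessThan_atLeast0 intro!: sum.cong)

text \<open>Equality case of the triangle inequality. After the sum is rotated onto the positive
  real axis, each real part is at most the modulus, and equality of the totals forces equality term
  by term.\<close>

lemma norm_sum_eq_imp_aligned:
  fixes z :: "'a \<Rightarrow> complex"
  assumes "finite S" and eq: "cmod (\<Sum>i\<in>S. z i) = (\<Sum>i\<in>S. cmod (z i))" and "i \<in> S"
  shows "z i = cmod (z i) * sgn (\<Sum>i\<in>S. z i)"
proof (cases "(\<Sum>i\<in>S. z i) = 0")
  case True
  then have "(\<Sum>i\<in>S. cmod (z i)) = 0" using eq by simp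
  then have "z i = 0" using assms by (simp add: sum_nonneg_eq_0_iff)
  \<comment> \<open>Here \<open>sgn 0 = 0\<close>, in agreement with the vanishing of every
    summand.\<close>
  then show ?thesis by simp
next
  case False
  define w where "w = sgn (\<Sum>i\<in>S. z i)"
  have w: "cmod w = 1" using False by (simp add: w_def norm_sgn)
  have unit: "cnj w * w = 1" using w by (simp add: complex_norm_square[symmetric] mult.commute)
  have "cnj w * (\<Sum>i\<in>S. z i) = cnj w * (w * cmod (\<Sum>i\<in>S. z i))"
    unfolding w_def by (simp add: sgn_eq False)
  also have "\<dots> = cmod (\<Sum>i\<in>S. z i)" using unit by (simp add: mult.assoc[symmetric])
  finally have "Re (cnj w * (\<Sum>i\<in>S. z i)) = (\<Sum>i\<in>S. cmod (z i))" using eq by simp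
  then have "(\<Sum>i\<in>S. cmod (z i) - Re (cnj w * z i)) = 0"
    by (simp add: sum_distrib_left sum_subtractf)
  moreover have le: "Re (cnj w * z j) \<le> cmod (z j)" for j
    using complex_Re_le_cmod[of "cnj w * z j"] w by (simp add: norm_mult)
  ultimately have Re: "Re (cnj w * z i) = cmod (z i)"
    using assms by (subst (asm) sum_nonneg_eq_0_iff) auto
  have "cmod (cnj w * z i) = cmod (z i)" using w by (simp add: norm_mult)
  with Re have "(Im (cnj w * z i))\<^sup>2 = 0"
    by (metis cmod_power2 add_cancel_left_right)
  then have "cnj w * z i = cmod (z i)" using Re by (simp add: complex_eq_iff)
  then have "w * (cnj w * z i) = w * cmod (z i)" by simp
  then show ?thesis using unit unfolding w_def[symmetric]
    by (metis mult.assoc mult.commute mult_1)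
qed

text \<open>A strictly superinvariant positive vector would force the powers of \<open>m\<close>, rescaled to
  spectral radius below 1, to be unbounded.\<close>

lemma spectral_radius_strict_superinvariant:
  fixes m :: "nat \<Rightarrow> nat \<Rightarrow> real"
  assumes n: "0 < n" and m: "\<And>i j. i < n \<Longrightarrow> j < n \<Longrightarrow> 0 < m i j"
    and z: "\<And>i. i < n \<Longrightarrow> 0 < z i"
    and r0: "0 \<le> r"
    and super: "\<And>i. i < n \<Longrightarrow> r * z i < (\<Sum>j<n. m i j * z j)"
  shows "\<exists>l x. (\<forall>i<n. (\<Sum>j<n. complex_of_real (m i j) * x j) = l * x i) \<and> (\<exists>i<n. x i \<noteq> 0) \<and> r < cmod l"
proof (rule ccontr)
  assume contr: "\<not> ?thesis"
  \<comment> \<open>Collatz-Wielandt quotients. Their minimum \<open>t\<close> exceeds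
    \<open>r\<close>, so some \<open>s\<close> fits strictly between; dividing by \<open>s\<close>
    brings the spectral radius below 1 while \<open>z\<close> still grows by the factor
    \<open>t / s > 1\<close>.\<close>
  define q where "q i = (\<Sum>j<n. m i j * z j) / z i" for i
  define t where "t = Min (q ` {..<n})"
  have "r < q i" if "i < n" for i
    unfolding q_def using super[OF that] z[OF that] by (simp add: pos_less_divide_eq)
  then have "r < t" unfolding t_def using n by (subst Min_gr_iff) auto
  then obtain s where s: "r < s" "s < t" using dense by blast
  then have s0: "0 < s" using r0 by linarith
  have tz: "t * z i \<le> (\<Sum>j<n. m i j * z j)" if "i < n" for i
  proof -
    have "t \<le> q i" unfolding t_def using that by (intro Min_le) auto
    then show ?thesis unfolding q_def using z[OF that] by (simp add: pos_le_divide_eq)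
  qed
  define N where "N = mat n n (\<lambda>(i, j). m i j / s)"
  let ?N = "map_mat complex_of_real N"
  have N: "N \<in> carrier_mat n n" and NC: "?N \<in> carrier_mat n n" by (simp_all add: N_def)
  have "spectral_radius ?N < 1"
  proof -
    obtain l where l: "eigenvalue ?N l" and sr: "spectral_radius ?N = cmod l"
      using spectral_radius_mem_max(1)[OF NC n] unfolding spectrum_def by auto
    from l obtain x where x: "x \<in> carrier_vec n" "x \<noteq> 0\<^sub>v n" and ev: "?N *\<^sub>v x = l \<cdot>\<^sub>v x"
      using NC unfolding eigenvalue_def eigenvector_def by auto
    have "(\<Sum>j<n. complex_of_real (m i j) * x $ j) = (s * l) * x $ i" if i: "i < n" for i
    proof -
      have "l * x $ i = (?N *\<^sub>v x) $ i" using ev x i by simp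
      also have "\<dots> = (\<Sum>j<n. complex_of_real (m i j / s) * x $ j)"
        unfolding mult_mat_vec_index_sum[OF NC x(1) i] using i by (intro sum.cong) (auto simp: N_def)
      also have "s * \<dots> = (\<Sum>j<n. complex_of_real (m i j) * x $ j)"
        unfolding sum_distrib_left using s0 by (intro sum.cong) auto
      finally show ?thesis by (simp add: algebra_simps)
    qed
    moreover have "\<exists>i<n. x $ i \<noteq> 0" using x by (metis eq_vecI carrier_vecD index_zero_vec)
    ultimately have "\<not> r < cmod (s * l)" using contr by blast
    then have "s * cmod l \<le> r" using s0 by (simp add: norm_mult)
    then have "s * cmod l < s * 1" using s(1) by simp
    then show ?thesis unfolding sr using s0 by simp
  qed
  \<comment> \<open>Spectral radius below 1 bounds all powers of the matrix uniformly, by way of the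
    Jordan normal form.\<close>
  from spectral_radius_jnf_norm_bound_less_1[OF NC this jordan_nf_exists[OF NC]] char_poly_factorized[OF NC]
  obtain b where b: "\<And>k. norm_bound (?N ^\<^sub>m k) b" by blast
  have entry: "(N ^\<^sub>m k) $$ (i, j) \<le> b" if "i < n" "j < n" for k i j
  proof -
    have "?N ^\<^sub>m k = map_mat complex_of_real (N ^\<^sub>m k)" by (simp add: of_real_hom.mat_hom_pow[OF N])
    moreover have "N ^\<^sub>m k \<in> carrier_mat n n" using N by simp
    ultimately have "cmod (complex_of_real ((N ^\<^sub>m k) $$ (i, j))) \<le> b"
      using b[of k] that N unfolding norm_bound_def by auto
    then show ?thesis by simp
  qed
  define y where "y = vec n z"
  have y: "y \<in> carrier_vec n" by (simp add: y_def)
  have Nw: "(N *\<^sub>v w) $ i = (\<Sum>j<n. m i j / s * w $ j)" if "w \<in> carrier_vec n" "i < n" for w i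
    unfolding mult_mat_vec_index_sum[OF N that] using that by (intro sum.cong) (auto simp: N_def)
  \<comment> \<open>Positive entries preserve \<open>t / s * w \<le> N w\<close> when
    \<open>w\<close> is replaced by \<open>N w\<close>, so the factor is gained at every
    step.\<close>
  have grow: "(t / s) ^ k * w $ i \<le> (N ^\<^sub>m k *\<^sub>v w) $ i"
    if "w \<in> carrier_vec n" "\<And>i. i < n \<Longrightarrow> t / s * w $ i \<le> (N *\<^sub>v w) $ i" "i < n" for k w i
    using that
  proof (induction k arbitrary: w i)
    case 0
    then show ?case using N by simp
  next
    case (Suc k)
    let ?w = "N *\<^sub>v w"
    have w: "?w \<in> carrier_vec n" using N Suc.prems(1) by simp
    have "t / s * ?w $ i \<le> (N *\<^sub>v ?w) $ i" if "i < n" for i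
    proof -
      have "t / s * ?w $ i = (\<Sum>j<n. m i j / s * (t / s * w $ j))"
        unfolding Nw[OF Suc.prems(1) that] sum_distrib_left by (simp add: mult_ac)
      also have "\<dots> \<le> (\<Sum>j<n. m i j / s * ?w $ j)"
        using m[OF that] s0 Suc.prems(2)
        by (intro sum_mono mult_left_mono) (auto simp: less_imp_le)
      finally show ?thesis unfolding Nw[OF w that] .
    qed
    from Suc.IH[OF w this Suc.prems(3)]
    have "(t / s) ^ k * ?w $ i \<le> (N ^\<^sub>m k *\<^sub>v ?w) $ i" .
    moreover have "(t / s) ^ k * (t / s * w $ i) \<le> (t / s) ^ k * ?w $ i"
      using Suc.prems s0 s by (intro mult_left_mono) auto
    moreover have "N ^\<^sub>m k *\<^sub>v ?w = N ^\<^sub>m Suc k *\<^sub>v w"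
      using N Suc.prems(1) by (simp add: assoc_mult_mat_vec[of _ n n _ n])
    ultimately show ?case by (simp add: mult_ac)
  qed
  have "(t / s) ^ k * z 0 \<le> b * (\<Sum>j<n. z j)" for k
  proof -
    have "(t / s) ^ k * y $ 0 \<le> (N ^\<^sub>m k *\<^sub>v y) $ 0"
    proof (rule grow[OF y _ n])
      fix i assume i: "i < n"
      have "t / s * y $ i = t * z i / s" using i by (simp add: y_def)
      also have "\<dots> \<le> (\<Sum>j<n. m i j * z j) / s" using tz[OF i] s0 by (simp add: divide_right_mono)
      also have "\<dots> = (N *\<^sub>v y) $ i"
        unfolding Nw[OF y i] sum_divide_distrib by (intro sum.cong) (auto simp: y_def)
      finally show "t / s * y $ i \<le> (N *\<^sub>v y) $ i" .
    qed
    also have "\<dots> = (\<Sum>j<n. (N ^\<^sub>m k) $$ (0, j) * y $ j)"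
      using N y n by (intro mult_mat_vec_index_sum) auto
    also have "\<dots> \<le> (\<Sum>j<n. b * z j)"
      using entry n z by (intro sum_mono) (auto simp: y_def intro!: mult_right_mono less_imp_le)
    finally show ?thesis using n by (simp add: y_def sum_distrib_left)
  qed
  moreover have "1 < t / s" using s s0 by simp
  then obtain k where "b * (\<Sum>j<n. z j) / z 0 < (t / s) ^ k" using real_arch_pow by blast
  ultimately show False using z[OF n] by (simp add: pos_divide_less_eq) (meson linorder_not_le)
qed

text \<open>The moduli of an eigenvector for the spectral radius \<open>r\<close> are
  superinvariant, and superinvariance at level \<open>r\<close> has to be an equality. Dominance is
  stated together with total nonvanishing of the eigenvectors, because cancelling one coordinate
  then shows that the eigenspace is one-dimensional.\<close>

lemma perron:
  fixes m :: "nat \<Rightarrow> nat \<Rightarrow> real"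
  assumes n: "0 < n" and m: "\<And>i j. i < n \<Longrightarrow> j < n \<Longrightarrow> 0 < m i j"
  obtains r v where "0 < r" "\<And>i. i < n \<Longrightarrow> 0 < v i"
    "\<And>i. i < n \<Longrightarrow> (\<Sum>j<n. m i j * v j) = r * v i"
    "\<And>l x. (\<And>i. i < n \<Longrightarrow> (\<Sum>j<n. complex_of_real (m i j) * x j) = l * x i) \<Longrightarrow>
      \<exists>i<n. x i \<noteq> 0 \<Longrightarrow> r \<le> cmod l \<Longrightarrow> l = r \<and> (\<forall>i<n. x i \<noteq> 0)"
proof -
  define M where "M = mat n n (\<lambda>(i, j). complex_of_real (m i j))"
  have M: "M \<in> carrier_mat n n" by (simp add: M_def)
  define r where "r = spectral_radius M"
  have Mx: "(M *\<^sub>v x) $ i = (\<Sum>j<n. complex_of_real (m i j) * x $ j)"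
    if "x \<in> carrier_vec n" "i < n" for x i
    unfolding mult_mat_vec_index_sum[OF M that] using that by (intro sum.cong) (auto simp: M_def)
  have le_r: "cmod l \<le> r"
    if ev: "\<And>i. i < n \<Longrightarrow> (\<Sum>j<n. complex_of_real (m i j) * x j) = l * x i" and nz: "\<exists>i<n. x i \<noteq> 0" for l x
  proof -
    have "M *\<^sub>v vec n x = l \<cdot>\<^sub>v vec n x"
      using M ev by (intro eq_vecI) (auto simp: Mx simp del: index_mult_mat_vec)
    moreover have "vec n x \<noteq> 0\<^sub>v n" using nz by (metis index_vec index_zero_vec(1))
    ultimately have "eigenvector M (vec n x) l" using M by (simp add: eigenvector_def)
    then have "l \<in> spectrum M" unfolding spectrum_def eigenvalue_def by auto
    then show ?thesis unfolding r_def using spectral_radius_mem_max(2)[OF M n] by blast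
  qed
  have r0: "0 \<le> r" using spectral_radius_mem_max(1)[OF M n] unfolding r_def by auto
  \<comment> \<open>A strict inequality in one coordinate would spread to all coordinates of the
    image \<open>z\<close> of \<open>y\<close>, since every entry of \<open>m\<close> is positive;
    \<open>spectral_radius_strict_superinvariant\<close> would then give an eigenvalue of modulus
    above \<open>r\<close>.\<close>
  have tight: "0 < y i \<and> (\<Sum>j<n. m i j * y j) = r * y i"
    if y: "\<And>i. i < n \<Longrightarrow> 0 \<le> y i" and nz: "\<exists>i<n. y i \<noteq> 0"
      and super: "\<And>i. i < n \<Longrightarrow> r * y i \<le> (\<Sum>j<n. m i j * y j)" and i: "i < n" for y i
  proof -
    define z where "z i = (\<Sum>j<n. m i j * y j)" for i
    have z_pos: "0 < z i" if i: "i < n" for i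
    proof -
      obtain k where "k < n" "y k \<noteq> 0" using nz by blast
      then have "0 < m i k * y k" using m[OF i] y[of k] by (simp add: order_less_le)
      then show ?thesis unfolding z_def using \<open>k < n\<close> m[OF i] y
        by (intro sum_pos2[of _ k]) (auto simp: less_imp_le)
    qed
    have eq: "z i = r * y i" if i: "i < n" for i
    proof (rule ccontr)
      assume "z i \<noteq> r * y i"
      then have lt: "r * y i < z i" using super[OF i] unfolding z_def by simp
      have "r * z k < (\<Sum>j<n. m k j * z j)" if k: "k < n" for k
      proof -
        have "r * z k = (\<Sum>j<n. m k j * (r * y j))"
          unfolding z_def sum_distrib_left by (simp add: mult_ac)
        also have "\<dots> < (\<Sum>j<n. m k j * z j)"
          using m[OF k] super lt i unfolding z_def
          by (intro sum_strict_mono_ex1) (auto intro!: mult_left_mono less_imp_le)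
        finally show ?thesis .
      qed
      from spectral_radius_strict_superinvariant[OF n m z_pos r0 this]
      show False using le_r by (metis linorder_not_le)
    qed
    have "y i \<noteq> 0" using z_pos[OF i] eq[OF i] by auto
    then show ?thesis using y[OF i] eq[OF i] unfolding z_def by simp
  qed
  have modulus: "r * cmod (x i) \<le> (\<Sum>j<n. m i j * cmod (x j))"
    if ev: "\<And>i. i < n \<Longrightarrow> (\<Sum>j<n. complex_of_real (m i j) * x j) = l * x i"
      and l: "r \<le> cmod l" and i: "i < n" for l x i
  proof -
    have "r * cmod (x i) \<le> cmod (l * x i)" using l by (simp add: norm_mult mult_right_mono)
    also have "\<dots> \<le> (\<Sum>j<n. cmod (complex_of_real (m i j) * x j))"
      unfolding ev[OF i, symmetric] by (rule norm_sum)
    also have "\<dots> = (\<Sum>j<n. m i j * cmod (x j))"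
      using m[OF i] by (intro sum.cong) (auto simp: norm_mult less_imp_le)
    finally show ?thesis .
  qed
  obtain l where l: "eigenvalue M l" and sr: "r = cmod l"
    using spectral_radius_mem_max(1)[OF M n] unfolding spectrum_def r_def by auto
  from l obtain x where x: "x \<in> carrier_vec n" "x \<noteq> 0\<^sub>v n" and ev: "M *\<^sub>v x = l \<cdot>\<^sub>v x"
    using M unfolding eigenvalue_def eigenvector_def by auto
  have x_nz: "\<exists>i<n. x $ i \<noteq> 0" using x by (metis eq_vecI carrier_vecD index_zero_vec)
  have x_ev: "(\<Sum>j<n. complex_of_real (m i j) * x $ j) = l * x $ i" if "i < n" for i
    using ev x that Mx[OF x(1) that] by simp
  define v where "v i = cmod (x $ i)" for i
  have v: "0 < v i \<and> (\<Sum>j<n. m i j * v j) = r * v i" if "i < n" for i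
    using that x_nz modulus[OF x_ev] sr unfolding v_def by (intro tight) auto
  have "0 < (\<Sum>j<n. m 0 j * v j)" using n m v by (intro sum_pos) auto
  with v[OF n] have "0 < r" by (simp add: zero_less_mult_iff)
  moreover have "l = r \<and> (\<forall>i<n. x i \<noteq> 0)"
    if ev: "\<And>i. i < n \<Longrightarrow> (\<Sum>j<n. complex_of_real (m i j) * x j) = l * x i"
      and nz: "\<exists>i<n. x i \<noteq> 0" and l: "r \<le> cmod l" for l x
  proof -
    have lr: "cmod l = r" using le_r[OF ev nz] l by simp
    have y: "0 < cmod (x i) \<and> (\<Sum>j<n. m i j * cmod (x j)) = r * cmod (x i)" if "i < n" for i
      using that nz modulus[OF ev l] by (intro tight) auto
    \<comment> \<open>Equality in the triangle inequality for row 0 aligns all its terms with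
      \<open>l * x 0\<close>. The term \<open>z 0\<close> is a positive multiple of
      \<open>x 0\<close>, hence \<open>l\<close> is positive and equals \<open>r\<close>.\<close>
    define z where "z j = complex_of_real (m 0 j) * x j" for j
    have cz: "cmod (z j) = m 0 j * cmod (x j)" if "j < n" for j
      using m[OF n that] by (simp add: z_def norm_mult)
    have S: "(\<Sum>j<n. z j) = l * x 0" using ev[OF n] by (simp add: z_def)
    have "cmod (\<Sum>j<n. z j) = (\<Sum>j<n. cmod (z j))"
      using y[OF n] cz unfolding S by (simp add: norm_mult lr)
    then have "z 0 = cmod (z 0) * sgn (l * x 0)"
      using norm_sum_eq_imp_aligned[of "{..<n}" z 0] n S by simp
    then have "x 0 = cmod (x 0) * sgn (l * x 0)"
      using cz[OF n] m[OF n n] unfolding z_def by simp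
    then have "x 0 = cmod (x 0) * (l * x 0 / (r * cmod (x 0)))"
      by (simp add: sgn_eq norm_mult lr)
    then have "l = r" using y[OF n] \<open>0 < r\<close> by (simp add: field_simps)
    then show ?thesis using y by auto
  qed
  ultimately show thesis using that[of r v] v by blast
qed

section \<open>Signs of the adjugate\<close>

text \<open>Eliminating the centre turns \<open>a\<close> into its Schur complement \<open>b\<close>, which has negative
  off-diagonal entries. The entries of \<open>y\<close> with the wrong sign would then give, after
  reinstating the centre, a vector whose sign \<open>a\<close> reverses.\<close>

lemma pendant_solution_signs:
  fixes a :: "nat \<Rightarrow> nat \<Rightarrow> real"
  assumes c: "c < n" and q: "q < n" "q \<noteq> c"
    and pos: "\<And>i j. i < n \<Longrightarrow> j < n \<Longrightarrow> 0 < a i j"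
    and minor: "\<And>i j. i < n \<Longrightarrow> j < n \<Longrightarrow> i \<noteq> c \<Longrightarrow> j \<noteq> c \<Longrightarrow> i \<noteq> j \<Longrightarrow> a i j * a c c < a i c * a c j"
    and minors_pos: "\<And>k f. strict_mono_on {..<k} f \<Longrightarrow> f ` {..<k} \<subseteq> {..<n} - {q} \<Longrightarrow>
      0 < det (mat k k (\<lambda>(i, j). a (f i) (f j)))"
    and yq: "0 < y q"
    and y: "\<And>i. i < n \<Longrightarrow> i \<noteq> q \<Longrightarrow> (\<Sum>j<n. a i j * y j) = 0"
  shows "y c < 0" and "\<And>i. i < n \<Longrightarrow> i \<noteq> c \<Longrightarrow> 0 < y i"
proof -
  \<comment> \<open>Schur complement of the centre entry: its row and column \<open>c\<close> are
    zero, and \<open>b y\<close> still vanishes outside row \<open>q\<close>.\<close>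
  define b where "b i j = a i j - a i c * a c j / a c c" for i j
  have acc: "0 < a c c" using pos c by blast
  have b_neg: "b i j < 0" if "i < n" "j < n" "i \<noteq> c" "j \<noteq> c" "i \<noteq> j" for i j
    using minor[OF that] acc unfolding b_def by (simp add: pos_less_divide_eq)
  have b_sum: "(\<Sum>j<n. b i j * y j) = 0" if "i < n" "i \<noteq> q" for i
  proof -
    have "(\<Sum>j<n. b i j * y j) = (\<Sum>j<n. a i j * y j) - a i c / a c c * (\<Sum>j<n. a c j * y j)"
      unfolding b_def sum_distrib_left sum_subtractf[symmetric] by (simp add: algebra_simps)
    then show ?thesis using y that c q by simp
  qed
  define J where "J = {j. j < n \<and> j \<noteq> c \<and> y j \<le> 0}"
  have J: "finite J" "J \<subseteq> {..<n} - {c}" "q \<notin> J" using yq unfolding J_def by auto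
  \<comment> \<open>The value at \<open>c\<close> makes row \<open>c\<close> of \<open>a x\<close>
    vanish, so that \<open>a x\<close> equals \<open>b\<close> applied to the part of
    \<open>y\<close> on \<open>J\<close>.\<close>
  define x where "x j = (if j \<in> J then y j else if j = c then - (\<Sum>j\<in>J. a c j * y j) / a c c else 0)" for j
  have ax: "(\<Sum>j<n. a i j * x j) = (\<Sum>j\<in>J. b i j * y j)" for i
  proof -
    have "(\<Sum>j<n. a i j * x j) = (\<Sum>j\<in>insert c J. a i j * x j)"
      using J c by (intro sum.mono_neutral_right) (auto simp: x_def)
    also have "\<dots> = a i c * x c + (\<Sum>j\<in>J. a i j * x j)" using J by (subst sum.insert) auto
    also have "x c = - (\<Sum>j\<in>J. a c j * y j) / a c c" using J by (auto simp: x_def)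
    also have "(\<Sum>j\<in>J. a i j * x j) = (\<Sum>j\<in>J. a i j * y j)"
      by (intro sum.cong) (auto simp: x_def)
    also have "a i c * (- (\<Sum>j\<in>J. a c j * y j) / a c c) = - (\<Sum>j\<in>J. a i c * a c j / a c c * y j)"
      by (simp add: sum_distrib_left sum_divide_distrib mult_ac)
    finally show ?thesis unfolding b_def by (simp add: left_diff_distrib sum_subtractf)
  qed
  have ax_pos: "0 < (\<Sum>j<n. a i j * x j)" if i: "i \<in> J" for i
  proof -
    have i': "i < n" "i \<noteq> c" "i \<noteq> q" using i J by auto
    \<comment> \<open>Row \<open>i\<close> of \<open>b y\<close> is zero, so the part over
      \<open>J\<close> is minus the part over the complement. There column \<open>c\<close>
      contributes nothing, the other terms are negative, and \<open>q\<close> is among them.\<close>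
    have "(\<Sum>j<n. b i j * y j) = (\<Sum>j\<in>{..<n} - J. b i j * y j) + (\<Sum>j\<in>J. b i j * y j)"
      using J by (intro sum.subset_diff) auto
    then have "(\<Sum>j\<in>J. b i j * y j) = (\<Sum>j\<in>{..<n} - J. - (b i j * y j))"
      using b_sum[OF i'(1,3)] by (simp add: sum_negf)
    also have "0 < \<dots>"
    proof (rule sum_pos2[of _ q])
      show "0 < - (b i q * y q)"
        using b_neg[of i q] i' q yq by (simp add: mult_neg_pos)
      fix j assume j: "j \<in> {..<n} - J"
      show "0 \<le> - (b i j * y j)"
      proof (cases "j = c")
        case True
        then show ?thesis using acc by (simp add: b_def)
      next
        case False
        then have "0 < y j" "b i j < 0" using j i i' b_neg[of i j] unfolding J_def by auto
        then show ?thesis by (simp add: mult_neg_pos less_imp_le)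
      qed
    qed (use q J in auto)
    finally show ?thesis unfolding ax .
  qed
  have x0: "x i = 0" if "i < n" for i
  proof (rule no_sign_reversal[where a = a and R = "{..<n} - {q}" and x = x and n = n, OF minors_pos])
    fix j assume j: "j \<in> {..<n} - {q}"
    consider "j \<in> J" | "j = c" | "x j = 0" by (cases "j \<in> J"; cases "j = c") (auto simp: x_def)
    then show "x j * (\<Sum>k<n. a j k * x k) \<le> 0"
    proof cases
      case 1
      then have "x j \<le> 0" by (simp add: x_def J_def)
      then show ?thesis using ax_pos[OF 1] by (simp add: mult_nonpos_nonneg)
    next
      case 2
      have "b c k = 0" for k using acc by (simp add: b_def)
      then have "(\<Sum>k<n. a j k * x k) = 0" unfolding ax 2 by simp
      then show ?thesis by simp
    qed simp
  qed (use that J q in \<open>auto simp: x_def\<close>)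
  have "J = {}" using ax_pos x0 J by (auto simp: less_le)
  then show pos_y: "\<And>i. i < n \<Longrightarrow> i \<noteq> c \<Longrightarrow> 0 < y i" unfolding J_def by force
  \<comment> \<open>Row \<open>c\<close> of the system fixes the sign at the centre: the positive
    pendant terms have to be balanced by \<open>y c\<close>.\<close>
  have "0 < (\<Sum>j\<in>{..<n} - {c}. a c j * y j)"
    using pos pos_y c q by (intro sum_pos) auto
  moreover have "a c c * y c + (\<Sum>j\<in>{..<n} - {c}. a c j * y j) = 0"
    using y[of c] c q by (simp add: sum.remove[of _ c])
  ultimately show "y c < 0" using acc by (smt (verit) mult_nonneg_nonneg)
qed

text \<open>Diagonal of the signature matrix \<open>S\<close>. Its entries square to 1, so
  conjugation by \<open>S\<close> is a similarity and keeps eigenvalues.\<close>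

definition star_sign :: "nat \<Rightarrow> nat \<Rightarrow> real" where
  "star_sign c i = (if i = c then 1 else -1)"

lemma adj_mat_index_sums:
  assumes A: "A \<in> carrier_mat n n" and "i < n" "j < n"
  shows "(\<Sum>k<n. A $$ (i, k) * adj_mat A $$ (k, j)) = (if i = j then det A else 0)"
    and "(\<Sum>k<n. adj_mat A $$ (i, k) * A $$ (k, j)) = (if i = j then det A else 0)"
proof -
  note adj = adj_mat[OF A]
  have "(A * adj_mat A) $$ (i, j) = (\<Sum>k<n. A $$ (i, k) * adj_mat A $$ (k, j))"
    "(adj_mat A * A) $$ (i, j) = (\<Sum>k<n. adj_mat A $$ (i, k) * A $$ (k, j))"
    using A adj(1) assms(2,3) by (auto simp: scalar_prod_def lessThan_atLeast0 intro!: sum.cong)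
  then show "(\<Sum>k<n. A $$ (i, k) * adj_mat A $$ (k, j)) = (if i = j then det A else 0)"
    "(\<Sum>k<n. adj_mat A $$ (i, k) * A $$ (k, j)) = (if i = j then det A else 0)"
    using adj(2,3) assms(2,3) by auto
qed

text \<open>Column \<open>q\<close> of the adjugate solves the system with right-hand side
  \<open>det A\<close> at \<open>q\<close> and 0 elsewhere, and its diagonal entry is a principal
  minor avoiding \<open>q\<close>, so \<open>pendant_solution_signs\<close> applies. The same lemma
  for the transpose handles the entries \<open>(q, c)\<close>.\<close>

lemma adj_mat_star_signs:
  fixes A :: "real mat"
  assumes A: "A \<in> carrier_mat n n" and c: "c < n"
    and pos: "\<And>i j. i < n \<Longrightarrow> j < n \<Longrightarrow> 0 < A $$ (i, j)"
    and minor: "\<And>i j. i < n \<Longrightarrow> j < n \<Longrightarrow> i \<noteq> c \<Longrightarrow> j \<noteq> c \<Longrightarrow> i \<noteq> j \<Longrightarrow>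
      A $$ (i, j) * A $$ (c, c) < A $$ (i, c) * A $$ (c, j)"
    and minors_pos: "\<And>q k f. q < n \<Longrightarrow> q \<noteq> c \<Longrightarrow> strict_mono_on {..<k} f \<Longrightarrow> f ` {..<k} \<subseteq> {..<n} - {q} \<Longrightarrow>
      0 < det (mat k k (\<lambda>(i, j). A $$ (f i, f j)))"
    and i: "i < n" and j: "j < n"
  shows "0 < star_sign c i * adj_mat A $$ (i, j) * star_sign c j"
proof -
  let ?K = "adj_mat A"
  have diag: "0 < ?K $$ (q, q)" if q: "q < n" "q \<noteq> c" for q
  proof -
    have "insert_index q ` {..<n - 1} \<subseteq> {..<n} - {q}"
      using q by (auto simp: insert_index_def)
    from minors_pos[OF q strict_mono_on_insert_index this]
    have "0 < det (mat_delete A q q)" using A by (simp add: mat_delete_eq_insert_index)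
    then show ?thesis using A q by (simp add: adj_mat_def cofactor_def)
  qed
  have col: "?K $$ (c, q) < 0 \<and> (\<forall>p<n. p \<noteq> c \<longrightarrow> 0 < ?K $$ (p, q))" if q: "q < n" "q \<noteq> c" for q
    using pendant_solution_signs[OF c q, of "\<lambda>i j. A $$ (i, j)" "\<lambda>i. ?K $$ (i, q)"]
      pos minor minors_pos[OF q] diag[OF q] adj_mat_index_sums(1)[OF A _ q(1)] by simp
  have row: "?K $$ (q, c) < 0" if q: "q < n" "q \<noteq> c" for q
  proof (rule pendant_solution_signs(1)[OF c q, of "\<lambda>i j. A $$ (j, i)" "\<lambda>i. ?K $$ (q, i)"])
    fix k and f :: "nat \<Rightarrow> nat"
    assume f: "strict_mono_on {..<k} f" "f ` {..<k} \<subseteq> {..<n} - {q}"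
    have "mat k k (\<lambda>(i, j). A $$ (f j, f i)) = transpose_mat (mat k k (\<lambda>(i, j). A $$ (f i, f j)))"
      by (intro eq_matI) auto
    then show "0 < det (mat k k (\<lambda>(i, j). A $$ (f j, f i)))"
      using minors_pos[OF q f] by (simp add: det_transpose[of _ k])
  next
    fix i assume "i < n" "i \<noteq> q"
    then show "(\<Sum>j<n. A $$ (j, i) * ?K $$ (q, j)) = 0"
      using adj_mat_index_sums(2)[OF A q(1), of i] by (simp add: mult.commute)
  qed (use pos minor diag[OF q] in \<open>simp_all add: mult.commute\<close>)
  have centre: "0 < ?K $$ (c, c)"
  \<comment> \<open>A 1 by 1 matrix has adjugate 1. Otherwise a pendant row of \<open>A\<close> is
    orthogonal to column \<open>c\<close> of the adjugate, whose entries off the centre are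
    negative.\<close>
  proof (cases "n = 1")
    case True
    then have "mat_delete A c c \<in> carrier_mat 0 0" using mat_delete_carrier[OF A, of c c] by simp
    then have "det (mat_delete A c c) = 1" by (simp add: det_dim_zero)
    then show ?thesis using A c by (simp add: adj_mat_def cofactor_def)
  next
    case False
    then obtain q where q: "q < n" "q \<noteq> c" using c
      by (metis One_nat_def Suc_lessI gr_implies_not_zero less_one neq0_conv)
    have "0 < (\<Sum>k\<in>{..<n} - {c}. - (A $$ (q, k) * ?K $$ (k, c)))"
      using pos row q by (intro sum_pos) (auto simp: mult_pos_neg)
    then have "(\<Sum>k\<in>{..<n} - {c}. A $$ (q, k) * ?K $$ (k, c)) < 0" by (simp add: sum_negf)
    moreover have "A $$ (q, c) * ?K $$ (c, c) + (\<Sum>k\<in>{..<n} - {c}. A $$ (q, k) * ?K $$ (k, c)) = 0"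
      using adj_mat_index_sums(1)[OF A q(1) c] q c by (simp add: sum.remove[of _ c])
    ultimately have "0 < A $$ (q, c) * ?K $$ (c, c)" by linarith
    then show ?thesis using pos[OF q(1) c] by (simp add: zero_less_mult_iff)
  qed
  show ?thesis
    using centre col[of j] row[of i] i j by (auto simp: star_sign_def)
qed

section \<open>Simple eigenvalues and path minors\<close>

text \<open>A one-dimensional kernel makes the adjugate a nonzero multiple of the outer product of
  \<open>v\<close> and \<open>u\<close>, so its trace is a nonzero multiple of the pairing of
  \<open>u\<close> with \<open>v\<close>.\<close>

lemma sum_cofactor_diagonal_nonzero:
  fixes C :: "'a :: field mat"
  assumes C: "C \<in> carrier_mat n n" and n: "0 < n"
    and v: "\<And>i. i < n \<Longrightarrow> (\<Sum>j<n. C $$ (i, j) * v j) = 0"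
    and u: "\<And>j. j < n \<Longrightarrow> (\<Sum>i<n. u i * C $$ (i, j)) = 0"
    and u0: "u 0 \<noteq> 0" and uv: "(\<Sum>i<n. u i * v i) \<noteq> 0"
    and ker: "\<And>x. (\<And>i. i < n \<Longrightarrow> (\<Sum>j<n. C $$ (i, j) * x j) = 0) \<Longrightarrow> \<exists>t. \<forall>i<n. x i = t * v i"
  shows "(\<Sum>i<n. cofactor C i i) \<noteq> 0"
proof -
  \<comment> \<open>the rows of \<open>C\<close> are dependent through \<open>u\<close>, so row 0 is replaced by \<open>u\<close> itself\<close>
  define B where "B = mat n n (\<lambda>(i, j). if i = 0 then u j else C $$ (i, j))"
  have B: "B \<in> carrier_mat n n" by (simp add: B_def)
  \<comment> \<open>A kernel vector of \<open>B\<close> is orthogonal to \<open>u\<close>. The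
    dependence of the rows puts it into the kernel of \<open>C\<close> as well, so it is a multiple
    of \<open>v\<close>, and the nonzero pairing makes it 0.\<close>
  have "det B \<noteq> 0"
  proof
    assume "det B = 0"
    then obtain x where x: "x \<in> carrier_vec n" "x \<noteq> 0\<^sub>v n" "B *\<^sub>v x = 0\<^sub>v n"
      using det_0_iff_vec_prod_zero[OF B] by blast
    have Bx: "(\<Sum>j<n. B $$ (i, j) * x $ j) = 0" if "i < n" for i
      using mult_mat_vec_index_sum[OF B x(1) that] x(3) that by simp
    have ux: "(\<Sum>j<n. u j * x $ j) = 0" using Bx[OF n] n by (simp add: B_def)
    have Cx: "(\<Sum>j<n. C $$ (i, j) * x $ j) = 0" if "i < n" "i \<noteq> 0" for i
      using Bx[OF that(1)] that by (simp add: B_def)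
    have "(\<Sum>i<n. u i * (\<Sum>j<n. C $$ (i, j) * x $ j)) = (\<Sum>j<n. (\<Sum>i<n. u i * C $$ (i, j)) * x $ j)"
      unfolding sum_distrib_left sum_distrib_right by (subst sum.swap) (simp add: mult.assoc)
    also have "\<dots> = 0" using u by simp
    also have "(\<Sum>i<n. u i * (\<Sum>j<n. C $$ (i, j) * x $ j)) = u 0 * (\<Sum>j<n. C $$ (0, j) * x $ j)"
      using n Cx by (simp add: sum.remove[of _ 0])
    finally have "(\<Sum>j<n. C $$ (0, j) * x $ j) = 0" using u0 by simp
    then obtain t where t: "\<forall>i<n. x $ i = t * v i" using ker[of "\<lambda>i. x $ i"] Cx by metis
    have "(\<Sum>j<n. u j * x $ j) = t * (\<Sum>i<n. u i * v i)"
      using t by (simp add: sum_distrib_left mult_ac)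
    then have "t = 0" using ux uv by simp
    then have "x = 0\<^sub>v n" using t x(1) by (intro eq_vecI) auto
    then show False using x(2) by simp
  qed
  have C0: "det C = 0"
  proof -
    have "\<exists>i<n. v i \<noteq> 0" using uv by (metis (no_types, lifting) lessThan_iff mult_zero_right sum.neutral)
    then have "vec n v \<noteq> 0\<^sub>v n" by (metis index_vec index_zero_vec(1))
    moreover have "C *\<^sub>v vec n v = 0\<^sub>v n"
    proof (rule eq_vecI)
      fix i assume "i < dim_vec (0\<^sub>v n :: 'a vec)"
      then show "(C *\<^sub>v vec n v) $ i = 0\<^sub>v n $ i"
        using v by (simp add: mult_mat_vec_index_sum[OF C] del: index_mult_mat_vec)
    qed (use C in simp)
    ultimately show ?thesis unfolding det_0_iff_vec_prod_zero[OF C] by (intro exI[of _ "vec n v"]) auto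
  qed
  let ?K = "adj_mat C"
  \<comment> \<open>\<open>C\<close> times its adjugate is 0, so every column of the adjugate is a
    multiple of \<open>v\<close>; the multipliers then form a left null vector of
    \<open>C\<close>.\<close>
  have "\<exists>t. \<forall>i<n. ?K $$ (i, j) = t * v i" if "j < n" for j
    using ker[of "\<lambda>i. ?K $$ (i, j)"] adj_mat_index_sums(1)[OF C _ that] C0 by simp
  then obtain t where K: "\<And>i j. i < n \<Longrightarrow> j < n \<Longrightarrow> ?K $$ (i, j) = t j * v i" by metis
  have v0: "\<exists>i<n. v i \<noteq> 0" using uv by (metis (no_types, lifting) lessThan_iff mult_zero_right sum.neutral)
  have tC: "(\<Sum>k<n. t k * C $$ (k, j)) = 0" if j: "j < n" for j
  proof -
    obtain i where i: "i < n" "v i \<noteq> 0" using v0 by blast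
    have "v i * (\<Sum>k<n. t k * C $$ (k, j)) = (\<Sum>k<n. ?K $$ (i, k) * C $$ (k, j))"
      using K i(1) by (simp add: sum_distrib_left mult_ac)
    also have "\<dots> = 0" using adj_mat_index_sums(2)[OF C i(1) j] C0 by simp
    finally show ?thesis using i by simp
  qed
  \<comment> \<open>\<open>B\<close> and \<open>C\<close> share the cofactors of row 0, so the
    expansion pairs \<open>u\<close> with column 0 of the adjugate and shows that this column is
    nonzero.\<close>
  have "det B = (\<Sum>j<n. B $$ (0, j) * cofactor B 0 j)" by (rule laplace_expansion_row[OF B n])
  also have "\<dots> = (\<Sum>j<n. u j * ?K $$ (j, 0))"
  proof (rule sum.cong)
    fix j assume j: "j \<in> {..<n}"
    have "mat_delete B 0 j = mat_delete C 0 j"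
      using C j by (intro eq_matI) (auto simp: mat_delete_def B_def)
    then show "B $$ (0, j) * cofactor B 0 j = u j * ?K $$ (j, 0)"
      using j n C by (simp add: B_def cofactor_def adj_mat_def)
  qed simp
  also have "\<dots> = t 0 * (\<Sum>j<n. u j * v j)" using K n by (simp add: sum_distrib_left mult_ac)
  finally have t0: "t 0 \<noteq> 0" using \<open>det B \<noteq> 0\<close> by auto
  \<comment> \<open>Removing the multiple of \<open>u\<close> that cancels coordinate 0 leaves a
    left null vector of \<open>C\<close> that the transpose of \<open>B\<close> annihilates too.
    Hence \<open>s = 0\<close>, and \<open>t\<close> is proportional to \<open>u\<close>.\<close>
  define s where "s j = t j - t 0 / u 0 * u j" for j
  have s0: "s 0 = 0" using u0 by (simp add: s_def)
  have sC: "(\<Sum>i<n. s i * C $$ (i, j)) = 0" if "j < n" for j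
  proof -
    have "(\<Sum>i<n. s i * C $$ (i, j)) = (\<Sum>i<n. t i * C $$ (i, j)) - t 0 / u 0 * (\<Sum>i<n. u i * C $$ (i, j))"
      unfolding s_def sum_distrib_left sum_subtractf[symmetric]
      by (intro sum.cong) (auto simp: left_diff_distrib)
    then show ?thesis using tC u that by simp
  qed
  have BT: "transpose_mat B \<in> carrier_mat n n" using B by simp
  have "transpose_mat B *\<^sub>v vec n s = 0\<^sub>v n"
  proof (rule eq_vecI)
    fix j assume "j < dim_vec (0\<^sub>v n :: 'a vec)"
    then have j: "j < n" by simp
    have "(transpose_mat B *\<^sub>v vec n s) $ j = (\<Sum>i<n. transpose_mat B $$ (j, i) * vec n s $ i)"
      by (rule mult_mat_vec_index_sum[OF BT _ j]) simp
    also have "\<dots> = (\<Sum>i<n. s i * C $$ (i, j))"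
      using j s0 by (intro sum.cong) (auto simp: B_def)
    finally show "(transpose_mat B *\<^sub>v vec n s) $ j = 0\<^sub>v n $ j" using sC[OF j] j by simp
  qed (use B in simp)
  moreover have "det (transpose_mat B) \<noteq> 0" using \<open>det B \<noteq> 0\<close> det_transpose[OF B] by simp
  ultimately have "vec n s = 0\<^sub>v n"
    using det_0_iff_vec_prod_zero[OF BT] vec_carrier[of n s] by metis
  then have s: "s j = 0" if "j < n" for j using that by (metis index_vec index_zero_vec(1))
  have "(\<Sum>i<n. cofactor C i i) = (\<Sum>i<n. t i * v i)"
  proof (rule sum.cong)
    fix i assume "i \<in> {..<n}"
    then have i: "i < n" by simp
    then have "cofactor C i i = ?K $$ (i, i)" using C by (simp add: adj_mat_def)
    then show "cofactor C i i = t i * v i" using K[OF i i] by simp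
  qed simp
  also have "\<dots> = t 0 / u 0 * (\<Sum>i<n. u i * v i)"
    unfolding sum_distrib_left
  proof (rule sum.cong)
    fix i assume "i \<in> {..<n}"
    then have "t i = t 0 / u 0 * u i" using s[of i] unfolding s_def by simp
    then show "t i * v i = t 0 / u 0 * (u i * v i)" by simp
  qed simp
  finally show ?thesis using t0 u0 uv by simp
qed

text \<open>\<open>sum_cofactor_diagonal_nonzero\<close> applies to \<open>\<mu> - A\<close>, so the
  derivative of the characteristic polynomial does not vanish at the root
  \<open>\<mu>\<close>.\<close>

lemma order_char_poly_eq_1:
  fixes A :: "'a :: field_char_0 mat"
  assumes A: "A \<in> carrier_mat n n" and n: "0 < n"
    and v: "\<And>i. i < n \<Longrightarrow> (\<Sum>j<n. A $$ (i, j) * v j) = \<mu> * v i"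
    and u: "\<And>j. j < n \<Longrightarrow> (\<Sum>i<n. u i * A $$ (i, j)) = \<mu> * u j"
    and u0: "u 0 \<noteq> 0" and uv: "(\<Sum>i<n. u i * v i) \<noteq> 0"
    and ker: "\<And>x. (\<And>i. i < n \<Longrightarrow> (\<Sum>j<n. A $$ (i, j) * x j) = \<mu> * x i) \<Longrightarrow> \<exists>t. \<forall>i<n. x i = t * v i"
  shows "order \<mu> (char_poly A) = 1"
proof -
  \<comment> \<open>\<open>char_matrix A \<mu>\<close> is \<open>A - \<mu>\<close>; the sign is
    reversed so that the diagonal cofactors of \<open>C\<close> are the values at
    \<open>\<mu>\<close> of the characteristic polynomials of
    \<open>mat_delete A i i\<close>.\<close>
  define C where "C = - char_matrix A \<mu>"
  have C: "C \<in> carrier_mat n n" using A by (simp add: C_def char_matrix_def)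
  have C_index: "C $$ (i, j) = (if i = j then \<mu> else 0) - A $$ (i, j)" if "i < n" "j < n" for i j
    using A that by (simp add: C_def char_matrix_def)
  have Cx: "(\<Sum>j<n. C $$ (i, j) * x j) = \<mu> * x i - (\<Sum>j<n. A $$ (i, j) * x j)" if "i < n" for i x
  proof -
    have "(\<Sum>j<n. C $$ (i, j) * x j) = (\<Sum>j<n. (if i = j then \<mu> * x j else 0) - A $$ (i, j) * x j)"
      using that by (intro sum.cong) (auto simp: C_index left_diff_distrib)
    then show ?thesis using that by (simp add: sum_subtractf)
  qed
  have uC: "(\<Sum>i<n. u i * C $$ (i, j)) = \<mu> * u j - (\<Sum>i<n. u i * A $$ (i, j))" if "j < n" for j
  proof -
    have "(\<Sum>i<n. u i * C $$ (i, j)) = (\<Sum>i<n. (if i = j then \<mu> * u i else 0) - u i * A $$ (i, j))"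
      using that by (intro sum.cong) (auto simp: C_index right_diff_distrib)
    then show ?thesis using that by (simp add: sum_subtractf)
  qed
  have trace: "(\<Sum>i<n. cofactor C i i) \<noteq> 0"
  proof (rule sum_cofactor_diagonal_nonzero[OF C n _ _ u0 uv])
    fix x assume 0: "\<And>i. i < n \<Longrightarrow> (\<Sum>j<n. C $$ (i, j) * x j) = 0"
    have "(\<Sum>j<n. A $$ (i, j) * x j) = \<mu> * x i" if "i < n" for i
      using Cx[OF that, of x] 0[OF that] by simp
    then show "\<exists>t. \<forall>i<n. x i = t * v i" by (rule ker)
  qed (use Cx v uC u in simp_all)
  have "poly (pderiv (char_poly A)) \<mu> = (\<Sum>i<n. poly (char_poly (mat_delete A i i)) \<mu>)"
    unfolding pderiv_char_poly[OF A] by (simp add: poly_sum)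
  also have "\<dots> = (\<Sum>i<n. cofactor C i i)"
  proof (rule sum.cong)
    fix i assume "i \<in> {..<n}"
    then have i: "i < n" by simp
    have D: "mat_delete A i i \<in> carrier_mat (n - 1) (n - 1)" by (rule mat_delete_carrier[OF A])
    have "- char_matrix (mat_delete A i i) \<mu> = mat_delete C i i"
      using A C i by (intro eq_matI) (auto simp: char_matrix_def mat_delete_def C_index)
    then show "poly (char_poly (mat_delete A i i)) \<mu> = cofactor C i i"
      by (simp add: char_poly_matrix[OF D] cofactor_def)
  qed simp
  finally have der: "poly (pderiv (char_poly A)) \<mu> \<noteq> 0" using trace by simp
  have "vec n v \<noteq> 0\<^sub>v n"
    using uv by (metis (no_types, lifting) index_vec index_zero_vec(1) lessThan_iff mult_zero_right sum.neutral)
  moreover have "A *\<^sub>v vec n v = \<mu> \<cdot>\<^sub>v vec n v"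
  proof (rule eq_vecI)
    fix i assume "i < dim_vec (\<mu> \<cdot>\<^sub>v vec n v)"
    then show "(A *\<^sub>v vec n v) $ i = (\<mu> \<cdot>\<^sub>v vec n v) $ i"
      using v by (simp add: mult_mat_vec_index_sum[OF A] del: index_mult_mat_vec)
  qed (use A in simp)
  ultimately have "eigenvalue A \<mu>"
    using A unfolding eigenvalue_def eigenvector_def by (intro exI[of _ "vec n v"]) auto
  then have "poly (char_poly A) \<mu> = 0" using eigenvalue_root_char_poly[OF A] by simp
  moreover have "char_poly A \<noteq> 0" using der by auto
  ultimately have "order \<mu> (char_poly A) = Suc (order \<mu> (pderiv (char_poly A)))"
    by (intro order_pderiv)
  then show ?thesis using order_0I[OF der] by simp
qed

text \<open>Apply \<open>f\<close> to \<open>g x = w x\<close>. No division occurs, so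
  \<open>\<delta>\<close> and \<open>w\<close> may be 0. This carries eigenvectors from the adjugate
  to \<open>A\<close> and back, and likewise for the transposes.\<close>

lemma eigenvector_quasi_inverse:
  fixes f g :: "nat \<Rightarrow> nat \<Rightarrow> 'a :: comm_ring_1"
  assumes fg: "\<And>i j. i < n \<Longrightarrow> j < n \<Longrightarrow> (\<Sum>k<n. f i k * g k j) = (if i = j then \<delta> else 0)"
    and x: "\<And>i. i < n \<Longrightarrow> (\<Sum>j<n. g i j * x j) = w * x i" and i: "i < n"
  shows "w * (\<Sum>j<n. f i j * x j) = \<delta> * x i"
proof -
  have "w * (\<Sum>j<n. f i j * x j) = (\<Sum>k<n. f i k * (\<Sum>j<n. g k j * x j))"
    using x by (simp add: sum_distrib_left mult_ac)
  also have "\<dots> = (\<Sum>j<n. (\<Sum>k<n. f i k * g k j) * x j)"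
    unfolding sum_distrib_left sum_distrib_right by (subst sum.swap) (simp add: mult.assoc)
  also have "\<dots> = (\<Sum>j<n. if i = j then \<delta> * x j else 0)"
    using fg i by (intro sum.cong) auto
  finally show ?thesis using i by simp
qed

section \<open>Minors along the paths of a star\<close>

lemma det_mat_2: "det (mat 2 2 f) = f (0, 0) * f (1, 1) - f (0, 1) * f (1, 0)"
  for f :: "nat \<times> nat \<Rightarrow> 'a :: comm_ring_1"
proof -
  have M: "mat 2 2 f \<in> carrier_mat 2 2" by simp
  have "det (mat_delete (mat 2 2 f) 0 0) = f (1, 1)" "det (mat_delete (mat 2 2 f) 0 1) = f (1, 0)"
    by (subst det_single; simp add: mat_delete_def)+
  then show ?thesis
    by (simp add: laplace_expansion_row[OF M, of 0] cofactor_def lessThan_nat_numeral lessThan_Suc)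
qed

lemma T_TP_path_minors:
  assumes T: "T_TP n E A" and xs: "is_path n E xs"
  shows "r < length xs \<Longrightarrow> s < length xs \<Longrightarrow> 0 < A $$ (xs ! r, xs ! s)"
    and "2 < length xs \<Longrightarrow> A $$ (xs ! 0, xs ! 2) * A $$ (xs ! 1, xs ! 1) < A $$ (xs ! 0, xs ! 1) * A $$ (xs ! 1, xs ! 2)"
proof -
  let ?M = "ordered_submatrix A xs"
  have dims: "dim_row ?M = length xs" "dim_col ?M = length xs" by (simp_all add: ordered_submatrix_def)
  have TP: "0 < det (mat k k (\<lambda>(i, j). A $$ (xs ! f i, xs ! g j)))"
    if f: "strict_mono_on {..<k} f" "f ` {..<k} \<subseteq> {..<length xs}"
      and g: "strict_mono_on {..<k} g" "g ` {..<k} \<subseteq> {..<length xs}" for k f g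
  proof -
    have "card (f ` {..<k}) = card (g ` {..<k})"
      using strict_mono_on_imp_inj_on[OF f(1)] strict_mono_on_imp_inj_on[OF g(1)] by (simp add: card_image)
    then have "0 < det (submatrix ?M (f ` {..<k}) (g ` {..<k}))"
      using T xs f(2) g(2) dims unfolding T_TP_def totally_positive_def by auto
    also have "submatrix ?M (f ` {..<k}) (g ` {..<k}) = mat k k (\<lambda>(i, j). ?M $$ (f i, g j))"
      using f g dims by (intro submatrix_strict_mono_image) auto
    also have "\<dots> = mat k k (\<lambda>(i, j). A $$ (xs ! f i, xs ! g j))"
      using f(2) g(2) by (intro eq_matI) (auto simp: ordered_submatrix_def subset_iff)
    finally show ?thesis .
  qed
  show "0 < A $$ (xs ! r, xs ! s)" if "r < length xs" "s < length xs"
  proof -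
    have "strict_mono_on {..<1 :: nat} (\<lambda>_. t)" for t :: nat by (rule strict_mono_onI) simp
    from TP[of 1 "\<lambda>_. r" "\<lambda>_. s", OF this _ this] that show ?thesis
      by (simp add: det_single image_subset_iff)
  qed
  show "A $$ (xs ! 0, xs ! 2) * A $$ (xs ! 1, xs ! 1) < A $$ (xs ! 0, xs ! 1) * A $$ (xs ! 1, xs ! 2)"
    if "2 < length xs"
  proof -
    \<comment> \<open>Rows 0, 1 and columns 1, 2 along the path: the middle vertex occurs in both,
      which puts its diagonal entry into the product being subtracted.\<close>
    have "0 < det (mat 2 2 (\<lambda>(i, j). A $$ (xs ! id i, xs ! Suc j)))"
      by (rule TP) (use that in \<open>auto simp: strict_mono_on_def\<close>)
    then show ?thesis unfolding det_mat_2 by (simp add: numeral_2_eq_2)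
  qed
qed

text \<open>Any two vertices of a star lie on a path with at most three vertices. The path through
  the centre gives the inequality that makes the off-diagonal Schur complement entries
  negative.\<close>

lemma star_T_TP_entries:
  assumes star: "is_star n c E" and T: "T_TP n E A" and i: "i < n" and j: "j < n"
  shows "0 < A $$ (i, j)"
    and "i \<noteq> c \<Longrightarrow> j \<noteq> c \<Longrightarrow> i \<noteq> j \<Longrightarrow> A $$ (i, j) * A $$ (c, c) < A $$ (i, c) * A $$ (c, j)"
proof -
  have c: "c < n" using star by (simp add: is_star_def)
  have edge: "{c, p} \<in> E" "{p, c} \<in> E" if "p < n" "p \<noteq> c" for p
    using star that by (auto simp: is_star_def insert_commute)
  have edge_path: "is_path n E [p, q]" if "p < n" "q < n" "p \<noteq> q" "p = c \<or> q = c" for p q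
    using that edge c by (auto simp: is_path_def)
  have path: "is_path n E [p, c, q]" if "p < n" "q < n" "p \<noteq> c" "q \<noteq> c" "p \<noteq> q" for p q
    using that edge c by (auto simp: is_path_def)
  consider "i = j" | "i \<noteq> j" "i = c \<or> j = c" | "i \<noteq> j" "i \<noteq> c" "j \<noteq> c" by blast
  then show "0 < A $$ (i, j)"
  proof cases
    case 1
    then show ?thesis using T_TP_path_minors(1)[OF T, of "[i]" 0 0] i by (simp add: is_path_def)
  next
    case 2
    then show ?thesis using T_TP_path_minors(1)[OF T edge_path[OF i j], of 0 1] by simp
  next
    case 3
    then show ?thesis using T_TP_path_minors(1)[OF T path[OF i j], of 0 2] by simp
  qed
  show "A $$ (i, j) * A $$ (c, c) < A $$ (i, c) * A $$ (c, j)" if "i \<noteq> c" "j \<noteq> c" "i \<noteq> j"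
    using T_TP_path_minors(2)[OF T path[OF i j that]] by simp
qed

lemma star_pendant:
  assumes "is_star n c E" "p < n" "p \<noteq> c"
  shows "pendant n E p"
proof -
  have "{e \<in> E. p \<in> e} = {{c, p}}" using assms by (auto simp: is_star_def)
  then show ?thesis using assms by (simp add: pendant_def)
qed

section \<open>From the Perron vectors of the signed adjugate to the smallest eigenvalue of
  \<open>A\<close>\<close>

theorem theorem4p1:
  fixes A :: "real mat" and n c :: nat and E :: "nat set set"
  assumes "A \<in> carrier_mat n n"
    and "is_star n c E"
    and "T_TP n E A"
    and "\<And>p. pendant n E p \<Longrightarrow> P_matrix (submatrix A ({..<n} - {p}) ({..<n} - {p}))"
  shows "\<exists>\<mu> :: real.
      (\<forall>z. min_modulus_eigenvalue (map_mat complex_of_real A) z \<longleftrightarrow> z = complex_of_real \<mu>) \<and>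
      order (complex_of_real \<mu>) (char_poly (map_mat complex_of_real A)) = 1 \<and>
      (\<exists>v. eigenvector A v \<mu> \<and> signed_according_to E v \<and> (\<forall>i < n. v $ i \<noteq> 0))"
proof -
  note A = assms(1) and star = assms(2) and T = assms(3) and P = assms(4)
  have c: "c < n" using star by (simp add: is_star_def)
  then have n: "0 < n" by simp
  have minors_pos: "0 < det (mat k k (\<lambda>(i, j). A $$ (f i, f j)))"
    if "q < n" "q \<noteq> c" "strict_mono_on {..<k} f" "f ` {..<k} \<subseteq> {..<n} - {q}" for q k f
    using P_matrix_submatrixD[OF P[OF star_pendant[OF star that(1,2)]] A _ that(3,4)] by auto
  let ?K = "adj_mat A" and ?s = "star_sign c"
  have ss: "?s i * ?s i = 1" and s_nz: "?s i \<noteq> 0" for i by (simp_all add: star_sign_def)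
  define m where "m i j = ?s i * ?K $$ (i, j) * ?s j" for i j
  have m: "0 < m i j" if "i < n" "j < n" for i j
    unfolding m_def
  proof (rule adj_mat_star_signs[OF A c])
    show "0 < A $$ (i, j)" if "i < n" "j < n" for i j
      by (rule star_T_TP_entries(1)[OF star T that])
    show "A $$ (i, j) * A $$ (c, c) < A $$ (i, c) * A $$ (c, j)"
      if "i < n" "j < n" "i \<noteq> c" "j \<noteq> c" "i \<noteq> j" for i j
      by (rule star_T_TP_entries(2)[OF star T that])
    show "0 < det (mat k k (\<lambda>(i, j). A $$ (f i, f j)))"
      if "q < n" "q \<noteq> c" "strict_mono_on {..<k} f" "f ` {..<k} \<subseteq> {..<n} - {q}" for q k f
      by (rule minors_pos[OF that])
  qed (rule that)+
  have Km: "?K $$ (i, j) = ?s i * m i j * ?s j" for i j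
  proof -
    have "?s i * m i j * ?s j = (?s i * ?s i) * ?K $$ (i, j) * (?s j * ?s j)"
      by (simp only: m_def mult_ac)
    then show ?thesis by (simp add: ss)
  qed
  obtain r v where r: "0 < r" and v: "\<And>i. i < n \<Longrightarrow> 0 < v i"
    and mv: "\<And>i. i < n \<Longrightarrow> (\<Sum>j<n. m i j * v j) = r * v i"
    and dominant: "\<And>l x. (\<And>i. i < n \<Longrightarrow> (\<Sum>j<n. complex_of_real (m i j) * x j) = l * x i) \<Longrightarrow>
      \<exists>i<n. x i \<noteq> 0 \<Longrightarrow> r \<le> cmod l \<Longrightarrow> l = r \<and> (\<forall>i<n. x i \<noteq> 0)"
  proof (rule perron[of n m, OF n], goal_cases)
    case (1 i j)
    show ?case by (rule m[OF 1(2,3)])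
  next
    case (2 r v)
    show ?case by (rule 2(1)[OF 2(2-5)])
  qed
  \<comment> \<open>Left Perron vector, obtained from the transpose. Its eigenvalue is identified
    with \<open>r\<close> by pairing \<open>u\<close> with \<open>v\<close>, a positive
    number.\<close>
  obtain r' u where u: "\<And>i. i < n \<Longrightarrow> 0 < u i"
    and um: "\<And>j. j < n \<Longrightarrow> (\<Sum>i<n. m i j * u i) = r' * u j"
  proof (rule perron[of n "\<lambda>i j. m j i", OF n m])
    fix r u
    assume "\<And>i. i < n \<Longrightarrow> 0 < u i" "\<And>i. i < n \<Longrightarrow> (\<Sum>j<n. m j i * u j) = r * u i"
    then show thesis by (rule that)
  qed
  have "r * (\<Sum>i<n. u i * v i) = (\<Sum>i<n. u i * (\<Sum>j<n. m i j * v j))"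
    using mv by (simp add: sum_distrib_left mult_ac)
  also have "\<dots> = (\<Sum>j<n. (\<Sum>i<n. m i j * u i) * v j)"
    unfolding sum_distrib_left sum_distrib_right by (subst sum.swap) (simp add: mult_ac)
  also have "\<dots> = r' * (\<Sum>i<n. u i * v i)"
    using um by (simp add: sum_distrib_left mult_ac)
  finally have "r' = r"
    using sum_pos[of "{..<n}" "\<lambda>i. u i * v i"] n u v by fastforce

  define v' where "v' i = ?s i * v i" for i
  define u' where "u' i = ?s i * u i" for i
  \<comment> \<open>\<open>A\<close> times its adjugate is \<open>det A\<close> times the identity,
    so an eigenvector of the adjugate for \<open>r\<close> is one of \<open>A\<close> for this
    value, whatever the sign of \<open>det A\<close>.\<close>
  define \<mu> where "\<mu> = det A / r"
  note AK = adj_mat_index_sums(1)[OF A] and KA = adj_mat_index_sums(2)[OF A]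
  have Kv': "(\<Sum>j<n. ?K $$ (i, j) * v' j) = r * v' i" if i: "i < n" for i
  proof -
    have "(\<Sum>j<n. ?K $$ (i, j) * v' j) = (\<Sum>j<n. ?s i * (m i j * v j) * (?s j * ?s j))"
      unfolding Km v'_def by (simp only: mult_ac)
    also have "\<dots> = ?s i * (\<Sum>j<n. m i j * v j)" unfolding ss by (simp add: sum_distrib_left)
    finally show ?thesis using mv[OF i] by (simp add: v'_def)
  qed
  have u'K: "(\<Sum>i<n. ?K $$ (i, j) * u' i) = r * u' j" if j: "j < n" for j
  proof -
    have "(\<Sum>i<n. ?K $$ (i, j) * u' i) = (\<Sum>i<n. ?s j * (m i j * u i) * (?s i * ?s i))"
      unfolding Km u'_def by (simp only: mult_ac)
    also have "\<dots> = ?s j * (\<Sum>i<n. m i j * u i)" unfolding ss by (simp add: sum_distrib_left)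
    finally show ?thesis using um[OF j] by (simp add: u'_def \<open>r' = r\<close>)
  qed
  have Av': "(\<Sum>j<n. A $$ (i, j) * v' j) = \<mu> * v' i" if "i < n" for i
    using eigenvector_quasi_inverse[of n "\<lambda>i j. A $$ (i, j)" "\<lambda>i j. ?K $$ (i, j)" "det A" v' r, OF AK Kv' that] r
    by (simp add: \<mu>_def field_simps)
  have u'A: "(\<Sum>i<n. A $$ (i, j) * u' i) = \<mu> * u' j" if "j < n" for j
  proof -
    have "(\<Sum>k<n. A $$ (k, i) * ?K $$ (j, k)) = (if i = j then det A else 0)" if "i < n" "j < n" for i j
      using KA[OF that(2,1)] by (auto simp: mult.commute split: if_splits)
    from eigenvector_quasi_inverse[of n "\<lambda>i j. A $$ (j, i)" "\<lambda>i j. ?K $$ (j, i)" "det A" u' r, OF this u'K that]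
    show ?thesis using r by (simp add: \<mu>_def field_simps)
  qed
  have v'_nz: "v' i \<noteq> 0" if "i < n" for i using v[OF that] s_nz by (simp add: v'_def)

  \<comment> \<open>for invertible \<open>A\<close>, eigenvalues \<open>w\<close> of \<open>A\<close> correspond to eigenvalues \<open>det A / w\<close> of the adjugate\<close>
  have adj_dominant: "w = \<mu> \<and> (\<forall>i<n. x i \<noteq> 0)"
    if x: "\<And>i. i < n \<Longrightarrow> (\<Sum>j<n. complex_of_real (A $$ (i, j)) * x j) = w * x i"
      and nz: "\<exists>i<n. x i \<noteq> 0" and w: "cmod w \<le> \<bar>\<mu>\<bar>" and d: "det A \<noteq> 0" for w x
  proof -
    have KAc: "(\<Sum>k<n. complex_of_real (?K $$ (i, k)) * complex_of_real (A $$ (k, j))) =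
        (if i = j then complex_of_real (det A) else 0)" if "i < n" "j < n" for i j
      using arg_cong[OF KA[OF that], of complex_of_real] by (simp split: if_splits)
    have Kx: "w * (\<Sum>j<n. complex_of_real (?K $$ (i, j)) * x j) = complex_of_real (det A) * x i" if "i < n" for i
      by (rule eigenvector_quasi_inverse[OF KAc x that])
    have w0: "w \<noteq> 0" using Kx nz d by auto
    define l where "l = complex_of_real (det A) / w"
    have "(\<Sum>j<n. complex_of_real (m i j) * (?s j * x j)) = l * (?s i * x i)" if i: "i < n" for i
    proof -
      have "complex_of_real (m i j) * (?s j * x j) = ?s i * (complex_of_real (?K $$ (i, j)) * x j)" for j
      proof -
        have "complex_of_real (m i j) * (?s j * x j) =
            ?s i * (complex_of_real (?K $$ (i, j)) * x j) * complex_of_real (?s j * ?s j)"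
          by (simp only: m_def of_real_mult mult_ac)
        then show ?thesis by (simp add: ss)
      qed
      then have "(\<Sum>j<n. complex_of_real (m i j) * (?s j * x j)) =
          ?s i * (\<Sum>j<n. complex_of_real (?K $$ (i, j)) * x j)"
        by (simp only: sum_distrib_left)
      then show ?thesis using Kx[OF i] w0 by (simp add: l_def field_simps)
    qed
    moreover have "\<exists>i<n. ?s i * x i \<noteq> 0" using nz s_nz by auto
    \<comment> \<open>The bound on \<open>w\<close> inverts: \<open>cmod l\<close> is
      \<open>\<bar>det A\<bar> / cmod w\<close>, hence at least
      \<open>\<bar>det A\<bar> / \<bar>\<mu>\<bar> = r\<close>.\<close>
    moreover have "r \<le> cmod l"
      using w w0 r d by (simp add: l_def \<mu>_def norm_divide field_simps)
    ultimately have *: "l = r \<and> (\<forall>i<n. ?s i * x i \<noteq> 0)" by (rule dominant)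
    then have "complex_of_real (det A) = r * w" using w0 by (simp add: l_def field_simps)
    then have "w = \<mu>" using r by (simp add: \<mu>_def)
    with * show ?thesis by auto
  qed
  \<comment> \<open>In the singular case \<open>A x = 0\<close>, so the P-matrix obtained by
    deleting \<open>q\<close> reverses the sign of \<open>x\<close> trivially. Otherwise dominance
    excludes a zero coordinate in a nonzero eigenvector.\<close>
  have ker0: "\<forall>i<n. x i = 0"
    if x: "\<And>i. i < n \<Longrightarrow> (\<Sum>j<n. A $$ (i, j) * x j) = \<mu> * x i" and q: "q < n" "q \<noteq> c" "x q = 0" for x q
  proof (cases "det A = 0")
    case True
    then have "(\<Sum>j<n. A $$ (i, j) * x j) = 0" if "i < n" for i using x[OF that] by (simp add: \<mu>_def)
    then show ?thesis
      using no_sign_reversal[where a = "\<lambda>i j. A $$ (i, j)" and R = "{..<n} - {q}" and n = n and x = x,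
          OF minors_pos[OF q(1,2)]] q(3)
      by auto
  next
    case False
    have "(\<Sum>j<n. complex_of_real (A $$ (i, j)) * complex_of_real (x j)) = complex_of_real \<mu> * complex_of_real (x i)"
      if "i < n" for i
      using arg_cong[OF x[OF that], of complex_of_real] by simp
    from adj_dominant[OF this _ _ False] q(1,3) show ?thesis by auto
  qed
  \<comment> \<open>Subtracting the multiple of \<open>v'\<close> that cancels the coordinate at a
    pendant vertex reduces this to \<open>ker0\<close>; with a single vertex the whole space is
    one-dimensional.\<close>
  have ker: "\<exists>t. \<forall>i<n. x i = t * v' i"
    if x: "\<And>i. i < n \<Longrightarrow> (\<Sum>j<n. A $$ (i, j) * x j) = \<mu> * x i" for x
  proof (cases "\<exists>q<n. q \<noteq> c")
    case False
    then show ?thesis using v'_nz c by (intro exI[of _ "x c / v' c"]) auto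
  next
    case True
    then obtain q where q: "q < n" "q \<noteq> c" by blast
    define t where "t = x q / v' q"
    have "\<forall>i<n. x i - t * v' i = 0"
    proof (rule ker0[OF _ q])
      fix i assume i: "i < n"
      have "(\<Sum>j<n. A $$ (i, j) * (x j - t * v' j)) =
          (\<Sum>j<n. A $$ (i, j) * x j) - t * (\<Sum>j<n. A $$ (i, j) * v' j)"
        unfolding sum_distrib_left sum_subtractf[symmetric] by (simp add: algebra_simps)
      then show "(\<Sum>j<n. A $$ (i, j) * (x j - t * v' j)) = \<mu> * (x i - t * v' i)"
        using x[OF i] Av'[OF i] by (simp add: algebra_simps)
    qed (use v'_nz q in \<open>simp add: t_def\<close>)
    then show ?thesis by auto
  qed

  have order_real: "order \<mu> (char_poly A) = 1"
  proof (rule order_char_poly_eq_1[OF A n Av'])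
    show "(\<Sum>i<n. u' i * A $$ (i, j)) = \<mu> * u' j" if "j < n" for j
      using u'A[OF that] by (simp add: mult.commute)
    show "u' 0 \<noteq> 0" using u[OF n] s_nz by (simp add: u'_def)
    have "u' i * v' i = u i * v i" for i
    proof -
      have "u' i * v' i = u i * v i * (?s i * ?s i)" by (simp only: u'_def v'_def mult_ac)
      then show ?thesis by (simp add: ss)
    qed
    then show "(\<Sum>i<n. u' i * v' i) \<noteq> 0"
      using sum_pos[of "{..<n}" "\<lambda>i. u i * v i"] n u v by fastforce
  qed (use ker in auto)
  let ?A = "map_mat complex_of_real A"
  have AC: "?A \<in> carrier_mat n n" using A by simp
  have order: "order (complex_of_real \<mu>) (char_poly ?A) = 1"
  proof -
    interpret map_poly_inj_idom_divide_hom complex_of_real ..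
    show ?thesis unfolding of_real_hom.char_poly_hom[OF A] order_hom by (rule order_real)
  qed

  have ev: "eigenvector A (vec n v') \<mu>"
  proof -
    have "A *\<^sub>v vec n v' = \<mu> \<cdot>\<^sub>v vec n v'"
    proof (rule eq_vecI)
      fix i assume "i < dim_vec (\<mu> \<cdot>\<^sub>v vec n v')"
      then show "(A *\<^sub>v vec n v') $ i = (\<mu> \<cdot>\<^sub>v vec n v') $ i"
        using Av' by (simp add: mult_mat_vec_index_sum[OF A] del: index_mult_mat_vec)
    qed (use A in simp)
    moreover have "vec n v' \<noteq> 0\<^sub>v n" using v'_nz[OF n] n by (metis index_vec index_zero_vec(1))
    ultimately show ?thesis using A by (simp add: eigenvector_def)
  qed
  have ev_mu: "eigenvalue ?A (complex_of_real \<mu>)"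
    using ev of_real_hom.eigenvalue_hom[OF A] unfolding eigenvalue_def by blast
  have small: "w = complex_of_real \<mu>" if w: "eigenvalue ?A w" "cmod w \<le> \<bar>\<mu>\<bar>" for w
  proof (cases "det A = 0")
    case True
    \<comment> \<open>Here \<open>\<mu> = 0\<close>, so the modulus bound alone gives
      \<open>w = 0\<close>.\<close>
    then show ?thesis using w(2) by (simp add: \<mu>_def)
  next
    case False
    from w(1) obtain x where x: "x \<in> carrier_vec n" "x \<noteq> 0\<^sub>v n" "?A *\<^sub>v x = w \<cdot>\<^sub>v x"
      using AC unfolding eigenvalue_def eigenvector_def by auto
    have "(\<Sum>j<n. complex_of_real (A $$ (i, j)) * x $ j) = w * x $ i" if "i < n" for i
    proof -
      have "(\<Sum>j<n. complex_of_real (A $$ (i, j)) * x $ j) = (?A *\<^sub>v x) $ i"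
        unfolding mult_mat_vec_index_sum[OF AC x(1) that] using A that by (intro sum.cong) auto
      then show ?thesis using x that by simp
    qed
    moreover have "\<exists>i<n. x $ i \<noteq> 0" using x by (metis eq_vecI carrier_vecD index_zero_vec)
    ultimately show ?thesis using adj_dominant[of "\<lambda>i. x $ i" w] w(2) False by blast
  qed
  \<comment> \<open>An eigenvalue not exceeding \<open>\<mu>\<close> in modulus equals
    \<open>\<mu>\<close>; this gives both minimality and uniqueness.\<close>
  have "min_modulus_eigenvalue ?A z \<longleftrightarrow> z = complex_of_real \<mu>" for z
    unfolding min_modulus_eigenvalue_def using ev_mu small
    by (metis linorder_linear norm_of_real order_refl)
  moreover have "signed_according_to E (vec n v')"
    unfolding signed_according_to_def
  proof (intro allI impI)
    fix i j assume "{i, j} \<in> E"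
    then have "i < n" "j < n" "i = c \<and> j \<noteq> c \<or> i \<noteq> c \<and> j = c"
      using star by (auto simp: is_star_def doubleton_eq_iff)
    then show "vec n v' $ i * vec n v' $ j < 0"
      using v by (auto simp: v'_def star_sign_def)
  qed
  ultimately show ?thesis using order ev v'_nz by (intro exI[of _ \<mu>] conjI exI[of _ "vec n v'"]) auto
qed

end
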